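(* Let $r\ge 2$ be an integer. Let $F_0$ be a graph, let $F$ be a connected graph obtained from $F_0$ by subdividing an edge, and let $F'$ be a graph obtained from $F$ by deleting a vertex. Let $c=c(n)$ be such that $ex(n,K_{r-1},F')\le cn$ for every $n$. Then for every $n$ the following hold. (i) $ex_r(n,\text{Berge-}F)\le ex(n,K_r,F)+2^{r-1}ex(n,F_0)+ex_r^{lin}(n,\text{Berge-}F)$. (ii) $ex_r(n,\text{Berge-}F)\le \max\left\{1,\frac{2c}{r}\right\}2^{r-1}ex(n,F_0)+ex_r^{lin}(n,\text{Berge-}F)$.
   Context: All graphs and hypergraphs are finite and simple (no repeated edges or hyperedges). A hypergraph $\mathcal{H}$ is a Berge copy of a graph $F$ (a Berge-$F$) if $V(F)\subset V(\mathcal{H})$ and there is a bijection $f:E(F)\to E(\mathcal{H})$ such that $e\subset f(e)$ for every $e\in E(F)$. A hypergraph is Berge-$F$-free if it contains no Berge-$F$ as a subhypergraph (not necessarily induced). A graph is $F$-free if it contains no subgraph (not necessarily induced) isomorphic to $F$. A hypergraph is $r$-uniform if all its hyperedges have exactly $r$ vertices; it is linear if any two distinct hyperedges share at most one vertex. Notation: - $ex(n,F)$ is the largest number of edges in an $F$-free graph on $n$ vertices. - $ex(n,H,F)$ is the largest number of copies of $H$ (subgraphs isomorphic to $H$) in an $F$-free graph on $n$ vertices. - $ex_r(n,\text{Berge-}F)$ is the largest number of hyperedges in an $r$-uniform Berge-$F$-free hypergraph on $n$ vertices. - $ex_r^{lin}(n,\text{Berge-}F)$ is the largest number of hyperedges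 in an $r$-uniform linear Berge-$F$-free hypergraph on $n$ vertices. - $K_s$ is the complete graph on $s$ vertices. Subdividing an edge $uv$ means deleting it and adding a new vertex $w$ together with the edges $uw$ and $vw$.
   Formalization: The hypothesis on c=c(n) is read as ex(m,K_{r-1},F') ≤ c(n)·m for every m ≤ n, which covers constant and nondecreasing c; with a bound only at m = n, part (ii) fails, e.g. for F_0 = K_{1,20}, F' = F minus its centre, r = 10, n = 21, c(21) = 0. *)

theory Defs
  imports Complex_Main
begin

record 'a hgraph =
  verts :: "'a set"
  edges :: "'a set set"

definition hypergraph :: "'a hgraph \<Rightarrow> bool" where
  "hypergraph H \<longleftrightarrow> finite (verts H) \<and> (\<forall>e\<in>edges H. e \<subseteq> verts H)"

definition uniform :: "nat \<Rightarrow> 'a hgraph \<Rightarrow> bool" where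
  "uniform r H \<longleftrightarrow> hypergraph H \<and> (\<forall>e\<in>edges H. card e = r)"

definition linear_hypergraph :: "'a hgraph \<Rightarrow> bool" where
  "linear_hypergraph H \<longleftrightarrow>
     hypergraph H \<and> (\<forall>e\<in>edges H. \<forall>f\<in>edges H. e \<noteq> f \<longrightarrow> card (e \<inter> f) \<le> 1)"

definition graph :: "'a hgraph \<Rightarrow> bool" where
  "graph G \<longleftrightarrow> uniform 2 G"

definition connected_graph :: "'a hgraph \<Rightarrow> bool" where
  "connected_graph G \<longleftrightarrow> graph G \<and> verts G \<noteq> {} \<and>
     (\<forall>u\<in>verts G. \<forall>v\<in>verts G. (u, v) \<in> {(x, y). {x, y} \<in> edges G}\<^sup>*)"

definition complete_graph :: "nat \<Rightarrow> nat hgraph" where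
  "complete_graph s = \<lparr>verts = {..<s}, edges = {e. e \<subseteq> {..<s} \<and> card e = 2}\<rparr>"

definition subdivide_edge :: "'a hgraph \<Rightarrow> 'a \<Rightarrow> 'a \<Rightarrow> 'a \<Rightarrow> 'a hgraph" where
  "subdivide_edge G u v w =
     \<lparr>verts = insert w (verts G), edges = (edges G - {{u, v}}) \<union> {{u, w}, {v, w}}\<rparr>"

definition delete_vertex :: "'a hgraph \<Rightarrow> 'a \<Rightarrow> 'a hgraph" where
  "delete_vertex G x = \<lparr>verts = verts G - {x}, edges = {e \<in> edges G. x \<notin> e}\<rparr>"

definition subhypergraph :: "'a hgraph \<Rightarrow> 'a hgraph \<Rightarrow> bool" where
  "subhypergraph S H \<longleftrightarrow> hypergraph S \<and> verts S \<subseteq> verts H \<and> edges S \<subseteq> edges H"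

definition isomorphic :: "'a hgraph \<Rightarrow> 'b hgraph \<Rightarrow> bool" where
  "isomorphic G H \<longleftrightarrow>
     (\<exists>\<phi>. bij_betw \<phi> (verts G) (verts H) \<and> edges H = (\<lambda>e. \<phi> ` e) ` edges G)"

definition copies :: "'a hgraph \<Rightarrow> 'b hgraph \<Rightarrow> 'b hgraph set" where
  "copies H G = {S. subhypergraph S G \<and> isomorphic H S}"

definition free_of :: "'a hgraph \<Rightarrow> 'b hgraph \<Rightarrow> bool" where
  "free_of F G \<longleftrightarrow> copies F G = {}"

definition berge_copy :: "'a hgraph \<Rightarrow> 'a hgraph \<Rightarrow> bool" where
  "berge_copy F H \<longleftrightarrow> verts F \<subseteq> verts H \<and>
     (\<exists>f. bij_betw f (edges F) (edges H) \<and> (\<forall>e\<in>edges F. e \<subseteq> f e))"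

(* F is an abstract graph, possibly over another vertex type, so it is first
   replaced by an isomorphic graph F1 on vertices of H. *)
definition berge_free :: "'a hgraph \<Rightarrow> 'b hgraph \<Rightarrow> bool" where
  "berge_free F H \<longleftrightarrow>
     \<not> (\<exists>F1 S. isomorphic F F1 \<and> subhypergraph S H \<and> berge_copy F1 S)"

(* The extremal functions range over all (hyper)graphs with n vertices of type
   nat, which covers every isomorphism class. The values are bounded for fixed n,
   so Sup is the maximum; Sup {} = 0 is the value when no n-vertex graph is F-free,
   which can happen only if F has no edges. *)

definition ex_edges :: "nat \<Rightarrow> 'a hgraph \<Rightarrow> nat" where
  "ex_edges n F = Sup {card (edges G) | G :: nat hgraph.
     graph G \<and> card (verts G) = n \<and> free_of F G}"

definition ex_copies :: "nat \<Rightarrow> 'b hgraph \<Rightarrow> 'a hgraph \<Rightarrow> nat" where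
  "ex_copies n H F = Sup {card (copies H G) | G :: nat hgraph.
     graph G \<and> card (verts G) = n \<and> free_of F G}"

definition ex_berge :: "nat \<Rightarrow> nat \<Rightarrow> 'a hgraph \<Rightarrow> nat" where
  "ex_berge r n F = Sup {card (edges H) | H :: nat hgraph.
     uniform r H \<and> card (verts H) = n \<and> berge_free F H}"

definition ex_berge_lin :: "nat \<Rightarrow> nat \<Rightarrow> 'a hgraph \<Rightarrow> nat" where
  "ex_berge_lin r n F = Sup {card (edges H) | H :: nat hgraph.
     uniform r H \<and> linear_hypergraph H \<and> card (verts H) = n \<and> berge_free F H}"

end

theory Submission
  imports Defs
begin

text \<open>Let \<open>H\<close> be a Berge-\<open>F\<close>-free \<open>r\<close>-uniform hypergraph on \<open>n\<close> vertices. Split off a maximal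
  linear subfamily \<open>L\<close> of its hyperedges; it accounts for the term \<open>ex_berge_lin\<close>. By maximality,
  each hyperedge of the rest \<open>R\<close> shares at least two vertices with some member of \<open>L\<close>, and the
  members of \<open>L\<close> remain available as spare hyperedges in the construction of Berge copies.

  Match hyperedges of \<open>R\<close> injectively to pairs of vertices that they contain, as many as possible.
  The matched pairs form a graph \<open>G\<close>, which is \<open>F\<close>-free, since the matching turns a copy of \<open>F\<close> in
  \<open>G\<close> into a Berge-\<open>F\<close>. Closing the set of unmatched hyperedges under alternating paths, as in
  Koenig's theorem, gives a set \<open>Z\<close> of hyperedges all of whose pairs belong to \<open>G\<close> (the blue
  pairs), while the hyperedges outside \<open>Z\<close> are matched to the other (red) pairs of \<open>G\<close>. So \<open>R\<close> has
  at most as many members as there are blue copies of \<open>K\<^sub>r\<close> and red edges together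
  (\<open>maximum_matching_split\<close>). The blue \<open>K\<^sub>r\<close> are at most \<open>ex(n, K\<^sub>r, F)\<close>; moreover, each
  neighbourhood in an \<open>F\<close>-free graph is \<open>F'\<close>-free, so that their number is also at most \<open>2c/r\<close>
  times the number of blue edges (\<open>clique_family_bound\<close>).

  Both inequalities now follow if \<open>G\<close> has at most \<open>2\<^sup>r\<^sup>-\<^sup>1 ex(n, F\<^sub>0)\<close> edges. Choose a
  vertex set \<open>A\<close> at random and keep a matched pair \<open>p\<close> of a hyperedge \<open>h\<close> if \<open>A\<close> separates \<open>p\<close> from
  \<open>h - p\<close>. A pair survives with probability \<open>2\<^sup>1\<^sup>-\<^sup>r\<close> (\<open>separation_average\<close>), so it
  suffices that the surviving graph is always \<open>F\<^sub>0\<close>-free. Since \<open>F\<^sub>0\<close> is connected, a surviving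
  copy of \<open>F\<^sub>0\<close> lies on one side of \<open>A\<close>, and the further vertices of its hyperedges lie on the other
  side. One of these vertices, \<open>b\<close>, is used to subdivide the required edge \<open>p\<close>, with the hyperedge
  \<open>h\<close> of \<open>p\<close> carrying one half (\<open>subdivided_berge_copy\<close>). For the other half \<open>{a, b}\<close>, where
  \<open>a \<in> p\<close>, an unused hyperedge is needed. If some choice of \<open>a \<in> p\<close> and \<open>b \<in> h - p\<close> gives a pair
  contained in a member of \<open>L\<close>, this member will do; call \<open>p\<close> good for \<open>h\<close> in this case. If \<open>p\<close>
  is not good, exchanging one vertex of \<open>p\<close> gives a pair \<open>{a, b}\<close> that is good for \<open>h\<close>
  (\<open>alternative_pair\<close>). Among all maximum matchings, take one in which as many hyperedges
  as possible have a good pair (\<open>prioritised_maximum_matching\<close>); then \<open>{a, b}\<close> is already matched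
  to some hyperedge, since otherwise \<open>h\<close> could be rematched to it. That hyperedge is unused by the
  copy of \<open>F\<^sub>0\<close>, because its pair \<open>{a, b}\<close> crosses the two sides.\<close>

section \<open>Embeddings and copies\<close>

lemma subset_card_2:
  assumes "card p = 2" "a \<in> p" "b \<in> p" "a \<noteq> b"
  shows "p = {a, b}"
proof -
  have "finite p" using assms(1) card.infinite by fastforce
  then have "{a, b} = p"
    using assms by (intro card_subset_eq) auto
  then show ?thesis by simp
qed

lemma not_free_of_iff_embedding:
  assumes "hypergraph F"
  shows "\<not> free_of F G \<longleftrightarrow>
    (\<exists>\<phi>. inj_on \<phi> (verts F) \<and> \<phi> ` verts F \<subseteq> verts G \<and> (\<forall>e\<in>edges F. \<phi> ` e \<in> edges G))"
proof
  assume "\<not> free_of F G"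
  then obtain S \<phi> where S: "subhypergraph S G" and "bij_betw \<phi> (verts F) (verts S)"
      and "edges S = (\<lambda>e. \<phi> ` e) ` edges F"
    unfolding free_of_def copies_def isomorphic_def by auto
  then show "\<exists>\<phi>. inj_on \<phi> (verts F) \<and> \<phi> ` verts F \<subseteq> verts G \<and> (\<forall>e\<in>edges F. \<phi> ` e \<in> edges G)"
    by (intro exI[of _ \<phi>]) (auto simp: bij_betw_def subhypergraph_def)
next
  assume "\<exists>\<phi>. inj_on \<phi> (verts F) \<and> \<phi> ` verts F \<subseteq> verts G \<and> (\<forall>e\<in>edges F. \<phi> ` e \<in> edges G)"
  then obtain \<phi> where \<phi>: "inj_on \<phi> (verts F)" "\<phi> ` verts F \<subseteq> verts G" "\<forall>e\<in>edges F. \<phi> ` e \<in> edges G"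
    by blast
  define S where "S = \<lparr>verts = \<phi> ` verts F, edges = (\<lambda>e. \<phi> ` e) ` edges F\<rparr>"
  have "hypergraph S"
    using assms unfolding hypergraph_def S_def by (auto simp: image_mono)
  then have "S \<in> copies F G"
    using \<phi> unfolding copies_def subhypergraph_def isomorphic_def S_def
    by (auto simp: bij_betw_def)
  then show "\<not> free_of F G" unfolding free_of_def by auto
qed

lemma not_berge_free_if_embedding:
  assumes F: "hypergraph F" and H: "hypergraph H"
    and \<phi>: "inj_on \<phi> (verts F)" "\<phi> ` verts F \<subseteq> verts H"
    and g: "inj_on g (edges F)" "\<And>e. e \<in> edges F \<Longrightarrow> g e \<in> edges H \<and> \<phi> ` e \<subseteq> g e"
  shows "\<not> berge_free F H"
proof -
  define F1 where "F1 = \<lparr>verts = \<phi> ` verts F, edges = (\<lambda>e. \<phi> ` e) ` edges F\<rparr>"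
  define S where "S = \<lparr>verts = verts H, edges = g ` edges F\<rparr>"
  have "isomorphic F F1"
    unfolding isomorphic_def F1_def using \<phi> by (auto simp: bij_betw_def)
  moreover have "subhypergraph S H"
    using H g(2) unfolding subhypergraph_def S_def hypergraph_def by auto
  moreover have "berge_copy F1 S"
  proof -
    have inj: "inj_on (\<lambda>e. \<phi> ` e) (edges F)"
      by (rule inj_on_subset[OF inj_on_image_Pow[OF \<phi>(1)]]) (use F in \<open>auto simp: hypergraph_def\<close>)
    define f where "f = g \<circ> inv_into (edges F) (\<lambda>e. \<phi> ` e)"
    have f: "f (\<phi> ` e) = g e" if "e \<in> edges F" for e
      using that inj by (simp add: f_def)
    have "inj_on f ((\<lambda>e. \<phi> ` e) ` edges F)"
    proof (rule inj_onI)
      fix x y assume "x \<in> (\<lambda>e. \<phi> ` e) ` edges F" "y \<in> (\<lambda>e. \<phi> ` e) ` edges F" "f x = f y"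
      then show "x = y" using f inj_onD[OF g(1)] by (elim imageE) metis
    qed
    then have "bij_betw f (edges F1) (edges S)"
      using f by (simp add: bij_betw_def F1_def S_def image_image)
    moreover have "\<forall>e\<in>edges F1. e \<subseteq> f e"
      using f g(2) by (auto simp: F1_def)
    moreover have "verts F1 \<subseteq> verts S" using \<phi>(2) by (simp add: F1_def S_def)
    ultimately show ?thesis unfolding berge_copy_def by blast
  qed
  ultimately show ?thesis unfolding berge_free_def by blast
qed

lemma berge_free_subfamily:
  assumes "berge_free F H" "L \<subseteq> edges H"
  shows "berge_free F \<lparr>verts = verts H, edges = L\<rparr>"
  using assms unfolding berge_free_def subhypergraph_def by (auto 4 4)

section \<open>The extremal numbers as maxima\<close>

lemma card_edges_le:
  assumes "hypergraph H"
  shows "card (edges H) \<le> 2 ^ card (verts H)"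
proof -
  have "edges H \<subseteq> Pow (verts H)" "finite (verts H)" using assms by (auto simp: hypergraph_def)
  then show ?thesis by (metis card_Pow card_mono finite_Pow_iff)
qed

lemma copies_bounded:
  assumes "hypergraph G"
  shows "finite (copies K G)" "card (copies K G) \<le> 2 ^ card (verts G) * 2 ^ 2 ^ card (verts G)"
proof -
  let ?X = "Pow (verts G) \<times> Pow (Pow (verts G))"
  have fin: "finite (verts G)" using assms by (simp add: hypergraph_def)
  have sub: "(\<lambda>S. (verts S, edges S)) ` copies K G \<subseteq> ?X"
    by (auto simp: copies_def subhypergraph_def hypergraph_def)
  have inj: "inj_on (\<lambda>S. (verts S, edges S)) (copies K G)"
    by (auto simp: inj_on_def)
  show "finite (copies K G)"
    using inj_on_finite[OF inj sub] fin by auto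
  have "card (copies K G) \<le> card ?X"
    using card_inj_on_le[OF inj sub] fin by auto
  also have "\<dots> = 2 ^ card (verts G) * 2 ^ 2 ^ card (verts G)"
    using fin by (simp add: card_cartesian_product card_Pow)
  finally show "card (copies K G) \<le> 2 ^ card (verts G) * 2 ^ 2 ^ card (verts G)" .
qed

lemma graph_hypergraph: "graph G \<Longrightarrow> hypergraph G"
  by (simp add: graph_def uniform_def)

lemma ex_edges_upper:
  fixes G :: "nat hgraph"
  assumes "graph G" "free_of F G"
  shows "card (edges G) \<le> ex_edges (card (verts G)) F"
  unfolding ex_edges_def
proof (rule cSup_upper)
  show "bdd_above {card (edges G') |G'::nat hgraph.
      graph G' \<and> card (verts G') = card (verts G) \<and> free_of F G'}"
    by (rule bdd_aboveI[where M = "2 ^ card (verts G)"])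
      (auto dest!: graph_hypergraph card_edges_le)
qed (use assms in blast)

lemma ex_copies_upper:
  fixes G :: "nat hgraph"
  assumes "graph G" "free_of F G"
  shows "card (copies K G) \<le> ex_copies (card (verts G)) K F"
  unfolding ex_copies_def
proof (rule cSup_upper)
  show "bdd_above {card (copies K G') |G'::nat hgraph.
      graph G' \<and> card (verts G') = card (verts G) \<and> free_of F G'}"
    by (rule bdd_aboveI[where M = "2 ^ card (verts G) * 2 ^ 2 ^ card (verts G)"])
      (auto dest!: graph_hypergraph copies_bounded(2)[of _ K])
qed (use assms in blast)

lemma ex_berge_lin_upper:
  fixes H :: "nat hgraph"
  assumes "uniform r H" "linear_hypergraph H" "berge_free F H"
  shows "card (edges H) \<le> ex_berge_lin r (card (verts H)) F"
  unfolding ex_berge_lin_def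
proof (rule cSup_upper)
  show "bdd_above {card (edges H') |H'::nat hgraph. uniform r H' \<and> linear_hypergraph H' \<and>
      card (verts H') = card (verts H) \<and> berge_free F H'}"
    by (rule bdd_aboveI[where M = "2 ^ card (verts H)"])
      (auto simp: uniform_def dest!: card_edges_le)
qed (use assms in blast)

text \<open>The value \<open>0\<close> arises as the supremum of the empty set when every \<open>r\<close>-uniform hypergraph on
  \<open>n\<close> vertices contains a Berge-\<open>F\<close>.\<close>

lemma ex_berge_attained:
  obtains "ex_berge r n F = 0"
  | H :: "nat hgraph" where "uniform r H" "card (verts H) = n" "berge_free F H"
      "ex_berge r n F = card (edges H)"
proof -
  let ?X = "{card (edges H) |H::nat hgraph. uniform r H \<and> card (verts H) = n \<and> berge_free F H}"
  show ?thesis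
  proof (cases "?X = {}")
    case True
    then have "ex_berge r n F = 0" unfolding ex_berge_def by (simp only: True Sup_nat_empty)
    then show ?thesis using that(1) by blast
  next
    case False
    have "x \<le> 2 ^ n" if "x \<in> ?X" for x
      using that by (auto simp: uniform_def dest!: card_edges_le)
    then have "finite ?X" by (metis (no_types, lifting) finite_nat_set_iff_bounded_le)
    then have "Max ?X \<in> ?X" using False by (rule Max_in)
    then have "ex_berge r n F \<in> ?X"
      unfolding ex_berge_def Sup_nat_def by (simp only: False if_False)
    then show ?thesis using that(2) by blast
  qed
qed

section \<open>Maximum matchings\<close>

definition matching :: "'h set \<Rightarrow> ('h \<Rightarrow> 'p \<Rightarrow> bool) \<Rightarrow> ('h \<rightharpoonup> 'p) \<Rightarrow> bool" where
  "matching R E m \<longleftrightarrow> dom m \<subseteq> R \<and> (\<forall>h p. m h = Some p \<longrightarrow> E h p) \<and> inj_on m (dom m)"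

lemma matching_extend:
  assumes "matching R E m" "h \<in> R" "E h p" "p \<notin> ran m"
  shows "matching R E (m(h \<mapsto> p))"
  using assms unfolding matching_def inj_on_def ran_def
  by (auto split: if_splits)

lemma matching_delete:
  assumes "matching R E m"
  shows "matching R E (m(h := None))"
  using assms unfolding matching_def inj_on_def by (auto split: if_splits)

lemma ran_delete_matched:
  assumes "inj_on m (dom m)" "m h = Some p"
  shows "ran (m(h := None)) = ran m - {p}"
proof (intro set_eqI iffI)
  fix x assume "x \<in> ran (m(h := None))"
  then obtain y where y: "m y = Some x" "y \<noteq> h" by (auto simp: ran_def split: if_splits)
  have "x \<noteq> p" using inj_onD[OF assms(1), of y h] y assms(2) by auto
  then show "x \<in> ran m - {p}" using y by (auto simp: ran_def)
next
  fix x assume "x \<in> ran m - {p}"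
  then obtain y where y: "m y = Some x" "x \<noteq> p" by (auto simp: ran_def)
  then have "y \<noteq> h" using assms(2) by auto
  then show "x \<in> ran (m(h := None))" using y(1) by (auto simp: ran_def)
qed

lemma inj_on_the_matching:
  assumes "matching R E m"
  shows "inj_on (\<lambda>h. the (m h)) (dom m)"
proof (rule inj_onI)
  fix x y assume "x \<in> dom m" "y \<in> dom m" "the (m x) = the (m y)"
  moreover from this have "m x = m y" by auto
  ultimately show "x = y" using assms inj_onD[of m "dom m" x y] by (simp add: matching_def)
qed

lemma ran_eq_the_image: "ran m = (\<lambda>h. the (m h)) ` dom m"
  by (force simp: ran_def)

lemma card_ran_matching:
  assumes "matching R E m"
  shows "card (ran m) = card (dom m)"
  unfolding ran_eq_the_image by (rule card_image[OF inj_on_the_matching[OF assms]])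

lemma finite_dom_matching:
  assumes "matching R E m" "finite R"
  shows "finite (dom m)" "finite (ran m)"
  using assms by (auto simp: matching_def finite_subset intro: finite_ran)

text \<open>Maximising the weight \<open>(|R| + 1)\<close> times the size plus the number of preferred pairs makes
  the size decisive and the preferred pairs the tie-breaker.\<close>

lemma prioritised_maximum_matching:
  assumes fin: "finite R"
  obtains m where "matching R E m"
    and "\<And>m'. matching R E m' \<Longrightarrow> card (ran m') \<le> card (ran m)"
    and "\<And>h p q. m h = Some p \<Longrightarrow> E h q \<Longrightarrow> \<not> good h p \<Longrightarrow> good h q \<Longrightarrow> q \<in> ran m"
proof -
  define W where "W m = {h \<in> dom m. good h (the (m h))}" for m :: "'a \<rightharpoonup> 'b"
  define wt where "wt m = card (ran m) * (card R + 1) + card (W m)" for m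
  have W_le: "card (W m) \<le> card R" and ran_le: "card (ran m) \<le> card R" if "matching R E m" for m
  proof -
    have "dom m \<subseteq> R" using that by (simp add: matching_def)
    then show "card (ran m) \<le> card R" "card (W m) \<le> card R"
      using fin card_ran_matching[OF that] by (auto simp: W_def intro!: card_mono)
  qed
  have "matching R E Map.empty" by (simp add: matching_def)
  moreover have "\<forall>m. matching R E m \<longrightarrow> wt m < card R * (card R + 1) + card R + 1"
    using W_le ran_le unfolding wt_def
    by (metis add.commute add_le_mono le_imp_less_Suc mult_le_mono1 plus_1_eq_Suc)
  ultimately obtain m where m: "matching R E m"
      and max: "\<And>m'. matching R E m' \<Longrightarrow> wt m' \<le> wt m"
    using ex_has_greatest_nat[of "matching R E" Map.empty wt] by blast
  have "card (ran m') \<le> card (ran m)" if m': "matching R E m'" for m'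
  proof (rule ccontr)
    assume "\<not> ?thesis"
    then have "(card (ran m) + 1) * (card R + 1) \<le> card (ran m') * (card R + 1)"
      by (intro mult_le_mono1) simp
    then show False using max[OF m'] W_le[OF m] by (simp add: wt_def)
  qed
  moreover have "q \<in> ran m" if hp: "m h = Some p" and "E h q" "\<not> good h p" "good h q" for h p q
  proof (rule ccontr)
    assume q: "q \<notin> ran m"
    let ?m = "m(h \<mapsto> q)"
    have hR: "h \<in> R" using m hp by (auto simp: matching_def)
    have m': "matching R E ?m" using matching_extend[OF m hR \<open>E h q\<close> q] .
    have dom: "dom ?m = dom m" using hp by auto
    then have "card (ran ?m) = card (ran m)"
      using card_ran_matching[OF m] card_ran_matching[OF m'] by simp
    moreover have "W m \<subseteq> W ?m" "h \<in> W ?m" "h \<notin> W m"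
      using that unfolding W_def by auto
    then have "W m \<subset> W ?m" by blast
    then have "card (W m) < card (W ?m)"
      using finite_dom_matching(1)[OF m' fin] by (intro psubset_card_mono) (auto simp: W_def)
    ultimately show False using max[OF m'] by (simp add: wt_def)
  qed
  ultimately show ?thesis using that m by blast
qed

text \<open>The set \<open>Z\<close> consists of the members of \<open>R\<close> reachable from unmatched ones by alternating
  paths, and \<open>Y k\<close> of those reachable in at most \<open>k\<close> rounds. Shifting the matching along a
  path that ends in \<open>h \<in> Y k\<close> frees \<open>h\<close> and keeps the matched objects; as it only changes the
  matching on \<open>Y k\<close>, the shifts can be composed. A free neighbour of \<open>h\<close> would then give a
  larger matching.\<close>

lemma maximum_matching_split:
  assumes fin: "finite R" and m: "matching R E m"
    and max: "\<And>m'. matching R E m' \<Longrightarrow> card (ran m') \<le> card (ran m)"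
  obtains Z where "Z \<subseteq> R" and "\<And>h p. h \<in> Z \<Longrightarrow> E h p \<Longrightarrow> p \<in> ran m" and "R - Z \<subseteq> dom m"
    and "\<And>h h' p. h \<in> R - Z \<Longrightarrow> h' \<in> Z \<Longrightarrow> m h = Some p \<Longrightarrow> \<not> E h' p"
proof -
  define Y where "Y = rec_nat (R - dom m) (\<lambda>_ S. S \<union> {h. \<exists>h'\<in>S. \<exists>p. E h' p \<and> m h = Some p})"
  have Y0: "Y 0 = R - dom m"
    and YS: "Y (Suc k) = Y k \<union> {h. \<exists>h'\<in>Y k. \<exists>p. E h' p \<and> m h = Some p}" for k
    by (simp_all add: Y_def)
  have domR: "dom m \<subseteq> R" using m by (simp add: matching_def)
  have YR: "Y k \<subseteq> R" for k
    by (induction k) (use domR in \<open>auto simp: Y0 YS\<close>)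
  have free: "\<exists>m'. matching R E m' \<and> ran m' = ran m \<and> h \<notin> dom m' \<and> (\<forall>x. x \<notin> Y k \<longrightarrow> m' x = m x)"
    if "h \<in> Y k" for h k
    using that
  proof (induction k arbitrary: h)
    case 0
    then show ?case using m by (auto simp: Y0)
  next
    case (Suc k)
    show ?case
    proof (cases "h \<in> Y k")
      case True
      then show ?thesis using Suc.IH[OF True] by (auto simp: YS)
    next
      case False
      then obtain h' p where h': "h' \<in> Y k" "E h' p" "m h = Some p"
        using Suc.prems by (auto simp: YS)
      obtain m' where m': "matching R E m'" "ran m' = ran m" "h' \<notin> dom m'"
          "\<forall>x. x \<notin> Y k \<longrightarrow> m' x = m x"
        using Suc.IH[OF h'(1)] by blast
      have m'h: "m' h = Some p" using m'(4) False h'(3) by simp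
      let ?d = "m'(h := None)"
      have d: "matching R E ?d" "ran ?d = ran m - {p}"
        using matching_delete[OF m'(1)] ran_delete_matched[where m = m' and h = h and p = p] m'h m'(1,2)
        by (auto simp: matching_def)
      have h'd: "?d h' = None" using m'(3) by auto
      have "h' \<in> R" using YR h'(1) by blast
      then have "matching R E (?d(h' \<mapsto> p))"
        using matching_extend[OF d(1) _ h'(2)] d(2) by blast
      moreover have "ran (?d(h' \<mapsto> p)) = ran m"
        using ran_map_upd[where m = ?d and a = h' and b = p] h'd d(2) h'(3) by (auto simp: ran_def)
      moreover have "h \<notin> dom (?d(h' \<mapsto> p))"
        using h'(1) False by auto
      moreover have "\<forall>x. x \<notin> Y (Suc k) \<longrightarrow> (?d(h' \<mapsto> p)) x = m x"
        using m'(4) h'(1) Suc.prems by (auto simp: YS)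
      ultimately show ?thesis by blast
    qed
  qed
  define Z where "Z = (\<Union>k. Y k)"
  show ?thesis
  proof (rule that[of Z])
    show "Z \<subseteq> R" using YR by (auto simp: Z_def)
    show "R - Z \<subseteq> dom m" using Y0 by (auto simp: Z_def)
    show "p \<in> ran m" if "h \<in> Z" and E: "E h p" for h p
    proof (rule ccontr)
      assume p: "p \<notin> ran m"
      obtain k where hk: "h \<in> Y k" using \<open>h \<in> Z\<close> by (auto simp: Z_def)
      obtain m' where m': "matching R E m'" "ran m' = ran m" "h \<notin> dom m'"
        using free[OF hk] by blast
      have "matching R E (m'(h \<mapsto> p))"
        using matching_extend[OF m'(1) _ E] YR hk m'(2) p by blast
      then have "card (ran (m'(h \<mapsto> p))) \<le> card (ran m)" by (rule max)
      moreover have "ran (m'(h \<mapsto> p)) = insert p (ran m)"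
        using m'(2,3) ran_map_upd[of m' h p] by auto
      ultimately show False using p finite_dom_matching(2)[OF m fin] by simp
    qed
    show "\<not> E h' p" if "h \<in> R - Z" "h' \<in> Z" "m h = Some p" for h h' p
    proof
      assume "E h' p"
      obtain k where "h' \<in> Y k" using \<open>h' \<in> Z\<close> by (auto simp: Z_def)
      then have "h \<in> Y (Suc k)" using \<open>E h' p\<close> that(3) by (auto simp: YS)
      then show False using that(1) by (auto simp: Z_def)
    qed
  qed
qed

section \<open>Double counting\<close>

lemma sum_card_swap:
  assumes "finite A" "finite B"
  shows "(\<Sum>a\<in>A. card {b \<in> B. P a b}) = (\<Sum>b\<in>B. card {a \<in> A. P a b})"
proof -
  have "(\<Sum>a\<in>A. card {b \<in> B. P a b}) = (\<Sum>a\<in>A. \<Sum>b\<in>B. if P a b then 1 else 0)"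
    using assms by (simp add: sum.If_cases Int_def)
  also have "\<dots> = (\<Sum>b\<in>B. \<Sum>a\<in>A. if P a b then 1 else 0)" by (rule sum.swap)
  also have "\<dots> = (\<Sum>b\<in>B. card {a \<in> A. P a b})"
    using assms by (simp add: sum.If_cases Int_def)
  finally show ?thesis .
qed

lemma sum_card_incidence:
  assumes "finite V" "finite E" "\<And>e. e \<in> E \<Longrightarrow> e \<subseteq> V \<and> card e = s"
  shows "(\<Sum>v\<in>V. card {e \<in> E. v \<in> e}) = s * card E"
proof -
  have "(\<Sum>v\<in>V. card {e \<in> E. v \<in> e}) = (\<Sum>e\<in>E. card {v \<in> V. v \<in> e})"
    using sum_card_swap[OF assms(1,2)] .
  also have "\<dots> = (\<Sum>e\<in>E. s)"
  proof (rule sum.cong)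
    fix e assume "e \<in> E"
    then have "{v \<in> V. v \<in> e} = e" using assms(3) by blast
    then show "card {v \<in> V. v \<in> e} = s" using assms(3) \<open>e \<in> E\<close> by simp
  qed simp
  finally show ?thesis by simp
qed

lemma card_sets_with_trace:
  assumes "finite V" "p \<subseteq> h" "h \<subseteq> V"
  shows "card {A \<in> Pow V. A \<inter> h = p} = 2 ^ (card V - card h)"
proof -
  have "bij_betw (\<lambda>X. X \<union> p) (Pow (V - h)) {A \<in> Pow V. A \<inter> h = p}"
    by (rule bij_betw_byWitness[where f' = "\<lambda>A. A - h"]) (use assms in auto)
  then have "card {A \<in> Pow V. A \<inter> h = p} = card (Pow (V - h))"
    by (simp add: bij_betw_same_card)
  also have "\<dots> = 2 ^ (card V - card h)"
    using assms by (simp add: card_Pow card_Diff_subset finite_subset)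
  finally show ?thesis .
qed

text \<open>A uniformly random \<open>A \<subseteq> V\<close> meets an \<open>r\<close>-set \<open>h\<close> in exactly \<open>p h\<close> or exactly \<open>h - p h\<close> with
  probability \<open>2 / 2\<^sup>r\<close>; the bound is the expectation of the number of such \<open>h\<close>.\<close>

lemma separation_average:
  assumes V: "finite V" and r: "r \<ge> 1"
    and T: "\<And>h. h \<in> T \<Longrightarrow> h \<subseteq> V \<and> card h = r \<and> p h \<subseteq> h \<and> p h \<noteq> {}"
    and k: "\<And>A. A \<subseteq> V \<Longrightarrow> card {h \<in> T. A \<inter> h = p h \<or> A \<inter> h = h - p h} \<le> k"
  shows "card T \<le> 2 ^ (r - 1) * k"
proof (cases "T = {}")
  case False
  have fT: "finite T"
    using T V by (auto intro!: finite_subset[of T "Pow V"])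
  obtain h0 where "h0 \<in> T" using False by blast
  then have rn: "r \<le> card V" using T V by (metis card_mono)
  have each: "card {A \<in> Pow V. A \<inter> h = p h \<or> A \<inter> h = h - p h} = 2 * 2 ^ (card V - r)"
    if "h \<in> T" for h
  proof -
    have h: "h \<subseteq> V" "card h = r" "p h \<subseteq> h" "p h \<noteq> {}" using T[OF that] by auto
    have "{A \<in> Pow V. A \<inter> h = p h \<or> A \<inter> h = h - p h} =
        {A \<in> Pow V. A \<inter> h = p h} \<union> {A \<in> Pow V. A \<inter> h = h - p h}" by blast
    moreover have "{A \<in> Pow V. A \<inter> h = p h} \<inter> {A \<in> Pow V. A \<inter> h = h - p h} = {}"
      using h(3,4) by blast
    ultimately show ?thesis
      using card_sets_with_trace[OF V h(3,1)] card_sets_with_trace[OF V _ h(1), of "h - p h"] V h(2)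
      by (simp add: card_Un_disjoint)
  qed
  have "card T * (2 * 2 ^ (card V - r)) =
      (\<Sum>h\<in>T. card {A \<in> Pow V. A \<inter> h = p h \<or> A \<inter> h = h - p h})"
    using each by simp
  also have "\<dots> = (\<Sum>A\<in>Pow V. card {h \<in> T. A \<inter> h = p h \<or> A \<inter> h = h - p h})"
    using sum_card_swap[OF fT, of "Pow V" "\<lambda>h A. A \<inter> h = p h \<or> A \<inter> h = h - p h"] V by simp
  also have "\<dots> \<le> (\<Sum>A\<in>Pow V. k)" using k by (intro sum_mono) simp
  also have "\<dots> = 2 ^ card V * k" using V by (simp add: card_Pow)
  also have "(2::nat) ^ card V = 2 ^ (r - 1) * (2 * 2 ^ (card V - r))"
  proof -
    have "card V = (r - 1) + Suc (card V - r)" using rn r by simp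
    then show ?thesis by (metis power_add power_Suc)
  qed
  finally have "card T * (2 * 2 ^ (card V - r)) \<le> (2 ^ (r - 1) * k) * (2 * 2 ^ (card V - r))"
    by (simp add: mult_ac)
  then show ?thesis by simp
qed simp

section \<open>Cliques in graphs without a given subgraph\<close>

lemma card_cliques_le_copies:
  assumes G: "graph G"
    and T: "\<And>h. h \<in> T \<Longrightarrow> h \<subseteq> verts G \<and> card h = s"
    and clique: "\<And>h e. h \<in> T \<Longrightarrow> e \<subseteq> h \<Longrightarrow> card e = 2 \<Longrightarrow> e \<in> edges G"
  shows "card T \<le> card (copies (complete_graph s) G)"
proof (rule card_inj_on_le)
  let ?K = "\<lambda>h. \<lparr>verts = h, edges = {e. e \<subseteq> h \<and> card e = 2}\<rparr>"
  show "inj_on ?K T" by (auto simp: inj_on_def)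
  show "finite (copies (complete_graph s) G)"
    using copies_bounded(1)[OF graph_hypergraph[OF G]] .
  have finV: "finite (verts G)" using graph_hypergraph[OF G] by (simp add: hypergraph_def)
  show "?K ` T \<subseteq> copies (complete_graph s) G"
  proof
    fix S assume "S \<in> ?K ` T"
    then obtain h where h: "h \<in> T" "S = ?K h" by blast
    have hV: "h \<subseteq> verts G" and hs: "card h = s" using T[OF h(1)] by auto
    have fh: "finite h" using hV finV finite_subset by blast
    then have "subhypergraph S G"
      using hV clique[OF h(1)] h(2) by (auto simp: subhypergraph_def hypergraph_def)
    moreover obtain \<phi> where \<phi>: "bij_betw \<phi> {..<s} h"
      using ex_bij_betw_nat_finite[OF fh] hs by (auto simp: atLeast0LessThan)
    have "{e. e \<subseteq> h \<and> card e = 2} = (\<lambda>e. \<phi> ` e) ` {e. e \<subseteq> {..<s} \<and> card e = 2}"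
    proof
      show "(\<lambda>e. \<phi> ` e) ` {e. e \<subseteq> {..<s} \<and> card e = 2} \<subseteq> {e. e \<subseteq> h \<and> card e = 2}"
        using \<phi> by (auto simp: bij_betw_def card_image inj_on_subset)
      show "{e. e \<subseteq> h \<and> card e = 2} \<subseteq> (\<lambda>e. \<phi> ` e) ` {e. e \<subseteq> {..<s} \<and> card e = 2}"
      proof
        fix e assume "e \<in> {e. e \<subseteq> h \<and> card e = 2}"
        then have "e \<subseteq> \<phi> ` {..<s}" "card e = 2" using \<phi> by (auto simp: bij_betw_def)
        then obtain d where d: "d \<subseteq> {..<s}" "e = \<phi> ` d" by (meson subset_imageE)
        then have "card d = 2"
          using \<phi> \<open>card e = 2\<close> by (metis bij_betw_def card_image inj_on_subset)
        then show "e \<in> (\<lambda>e. \<phi> ` e) ` {e. e \<subseteq> {..<s} \<and> card e = 2}" using d by blast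
      qed
    qed
    then have "isomorphic (complete_graph s) S"
      using \<phi> h(2) unfolding isomorphic_def complete_graph_def by auto
    ultimately show "S \<in> copies (complete_graph s) G" by (simp add: copies_def)
  qed
qed

definition neighbourhood :: "'a hgraph \<Rightarrow> 'a \<Rightarrow> 'a hgraph" where
  "neighbourhood G v = \<lparr>verts = {y. y \<noteq> v \<and> {v, y} \<in> edges G},
     edges = {e \<in> edges G. \<forall>y\<in>e. y \<noteq> v \<and> {v, y} \<in> edges G}\<rparr>"

lemma graph_edge_card: "graph G \<Longrightarrow> e \<in> edges G \<Longrightarrow> card e = 2"
  by (simp add: graph_def uniform_def)

lemma graph_edge_subset: "graph G \<Longrightarrow> e \<in> edges G \<Longrightarrow> e \<subseteq> verts G"
  by (simp add: graph_def uniform_def hypergraph_def)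

lemma graph_finite:
  assumes "graph G"
  shows "finite (verts G)" "finite (edges G)"
proof -
  show fin: "finite (verts G)" using assms by (simp add: graph_def uniform_def hypergraph_def)
  show "finite (edges G)"
    by (rule finite_subset[of _ "Pow (verts G)"]) (use assms graph_edge_subset fin in auto)
qed

lemma neighbourhood_verts_subset:
  assumes "graph G"
  shows "verts (neighbourhood G v) \<subseteq> verts G"
  using graph_edge_subset[OF assms] by (auto simp: neighbourhood_def)

lemma graph_neighbourhood:
  assumes "graph G"
  shows "graph (neighbourhood G v)"
proof -
  have "finite (verts (neighbourhood G v))"
    using neighbourhood_verts_subset[OF assms] graph_finite(1)[OF assms] finite_subset by blast
  then show ?thesis
    using assms by (auto simp: graph_def uniform_def hypergraph_def neighbourhood_def)
qed

text \<open>A copy of \<open>F - x\<close> in a neighbourhood extends to a copy of \<open>F\<close>, with the centre in the role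
  of \<open>x\<close>.\<close>

lemma neighbourhood_free_of_delete_vertex:
  assumes F: "graph F" and x: "x \<in> verts F" and G: "graph G" and free: "free_of F G"
    and v: "v \<in> verts G"
  shows "free_of (delete_vertex F x) (neighbourhood G v)"
proof (rule ccontr)
  let ?F' = "delete_vertex F x"
  have F'h: "hypergraph ?F'"
    using graph_hypergraph[OF F] by (auto simp: hypergraph_def delete_vertex_def)
  assume "\<not> ?thesis"
  then obtain \<phi> where \<phi>: "inj_on \<phi> (verts ?F')" "\<phi> ` verts ?F' \<subseteq> verts (neighbourhood G v)"
      "\<forall>e\<in>edges ?F'. \<phi> ` e \<in> edges (neighbourhood G v)"
    unfolding not_free_of_iff_embedding[OF F'h] by blast
  have nb: "\<phi> y \<noteq> v \<and> {v, \<phi> y} \<in> edges G" if "y \<in> verts F" "y \<noteq> x" for y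
    using that \<phi>(2) by (auto simp: delete_vertex_def neighbourhood_def)
  let ?\<psi> = "\<phi>(x := v)"
  have "inj_on ?\<psi> (verts F)"
    using \<phi>(1) nb by (auto simp: inj_on_def delete_vertex_def)
  moreover have "?\<psi> ` verts F \<subseteq> verts G"
    using nb graph_edge_subset[OF G] v by auto
  moreover have "?\<psi> ` e \<in> edges G" if e: "e \<in> edges F" for e
  proof (cases "x \<in> e")
    case False
    then have "?\<psi> ` e = \<phi> ` e" by (auto intro!: image_cong)
    moreover have "\<phi> ` e \<in> edges G"
      using \<phi>(3) False e by (auto simp: delete_vertex_def neighbourhood_def)
    ultimately show ?thesis by metis
  next
    case True
    obtain y where y: "y \<in> e" "y \<noteq> x"
      using graph_edge_card[OF F e] True by (metis card_2_iff insert_iff)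
    then have "e = {x, y}" using subset_card_2[OF graph_edge_card[OF F e]] True by metis
    then have "?\<psi> ` e = {v, \<phi> y}" using y by auto
    then show ?thesis using nb y graph_edge_subset[OF F e] by auto
  qed
  ultimately have "\<not> free_of F G"
    unfolding not_free_of_iff_embedding[OF graph_hypergraph[OF F]] by blast
  then show False using free by simp
qed

lemma card_neighbourhood:
  assumes G: "graph G"
  shows "card (verts (neighbourhood G v)) = card {e \<in> edges G. v \<in> e}"
proof -
  have "bij_betw (\<lambda>y. {v, y}) (verts (neighbourhood G v)) {e \<in> edges G. v \<in> e}"
    unfolding bij_betw_def
  proof
    show "inj_on (\<lambda>y. {v, y}) (verts (neighbourhood G v))"
      by (auto simp: inj_on_def doubleton_eq_iff)
    show "(\<lambda>y. {v, y}) ` verts (neighbourhood G v) = {e \<in> edges G. v \<in> e}"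
    proof
      show "{e \<in> edges G. v \<in> e} \<subseteq> (\<lambda>y. {v, y}) ` verts (neighbourhood G v)"
      proof
        fix e assume e: "e \<in> {e \<in> edges G. v \<in> e}"
        then have c2: "card e = 2" using graph_edge_card[OF G] by blast
        then obtain y where y: "y \<in> e" "y \<noteq> v"
          by (metis card_2_iff insert_iff)
        then have "e = {v, y}" using subset_card_2[OF c2] e by blast
        then show "e \<in> (\<lambda>y. {v, y}) ` verts (neighbourhood G v)"
          using y e by (auto simp: neighbourhood_def)
      qed
    qed (auto simp: neighbourhood_def)
  qed
  then show ?thesis by (rule bij_betw_same_card)
qed

text \<open>The cliques through a vertex \<open>v\<close> are, without \<open>v\<close>, cliques in its neighbourhood, so there
  are at most \<open>C\<close> times the degree of \<open>v\<close> of them; summing over \<open>v\<close> counts each clique \<open>r\<close> times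
  and each edge twice.\<close>

lemma clique_family_bound:
  fixes G :: "nat hgraph" and C :: real
  assumes F: "graph F" and x: "x \<in> verts F" and G: "graph G" and free: "free_of F G"
    and C: "\<And>k. k \<le> card (verts G) \<Longrightarrow>
        real (ex_copies k (complete_graph (r - 1)) (delete_vertex F x)) \<le> C * real k"
    and Z: "\<And>h. h \<in> Z \<Longrightarrow> h \<subseteq> verts G \<and> card h = r"
    and clique: "\<And>h e. h \<in> Z \<Longrightarrow> e \<subseteq> h \<Longrightarrow> card e = 2 \<Longrightarrow> e \<in> edges G"
  shows "real r * real (card Z) \<le> 2 * C * real (card (edges G))"
proof -
  note fin = graph_finite[OF G]
  have fZ: "finite Z" by (rule finite_subset[of _ "Pow (verts G)"]) (use Z fin in auto)
  have local: "real (card {h \<in> Z. v \<in> h}) \<le> C * real (card {e \<in> edges G. v \<in> e})"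
    if v: "v \<in> verts G" for v
  proof -
    let ?N = "neighbourhood G v"
    let ?T = "(\<lambda>h. h - {v}) ` {h \<in> Z. v \<in> h}"
    have "card {h \<in> Z. v \<in> h} = card ?T"
      by (rule card_image[symmetric]) (auto simp: inj_on_def)
    also have "card ?T \<le> card (copies (complete_graph (r - 1)) ?N)"
    proof (rule card_cliques_le_copies[OF graph_neighbourhood[OF G]])
      fix t assume "t \<in> ?T"
      then obtain h where h: "h \<in> Z" "v \<in> h" "t = h - {v}" by blast
      have fh: "finite h" using Z[OF h(1)] fin finite_subset by blast
      have adj: "{v, y} \<in> edges G" if "y \<in> t" for y
        using clique[OF h(1), of "{v, y}"] that h by auto
      show "t \<subseteq> verts ?N \<and> card t = r - 1"
        using adj h fh Z[OF h(1)] by (auto simp: neighbourhood_def)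
      show "e \<in> edges ?N" if "e \<subseteq> t" "card e = 2" for e
        using clique[OF h(1), of e] adj that h by (auto simp: neighbourhood_def)
    qed
    also have "\<dots> \<le> ex_copies (card (verts ?N)) (complete_graph (r - 1)) (delete_vertex F x)"
      by (rule ex_copies_upper[OF graph_neighbourhood[OF G]
            neighbourhood_free_of_delete_vertex[OF F x G free v]])
    finally have "real (card {h \<in> Z. v \<in> h}) \<le>
        real (ex_copies (card (verts ?N)) (complete_graph (r - 1)) (delete_vertex F x))"
      by simp
    also have "\<dots> \<le> C * real (card (verts ?N))"
      by (rule C) (use neighbourhood_verts_subset[OF G] fin in \<open>simp add: card_mono\<close>)
    finally show ?thesis by (simp add: card_neighbourhood[OF G])
  qed
  have "real r * real (card Z) = real (\<Sum>v\<in>verts G. card {h \<in> Z. v \<in> h})"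
    using sum_card_incidence[OF fin(1) fZ Z] by simp
  also have "\<dots> \<le> C * real (\<Sum>v\<in>verts G. card {e \<in> edges G. v \<in> e})"
    using local by (simp add: sum_distrib_left sum_mono)
  also have "(\<Sum>v\<in>verts G. card {e \<in> edges G. v \<in> e}) = 2 * card (edges G)"
    by (rule sum_card_incidence[OF fin]) (use graph_edge_card[OF G] graph_edge_subset[OF G] in blast)
  finally show ?thesis by simp
qed

section \<open>Berge copies of a subdivision\<close>

lemma side_constant_if_subdivision_connected:
  assumes F: "connected_graph F" "F = subdivide_edge F0 u v w"
    and uv: "{u, v} \<in> edges F0" and w: "w \<notin> verts F0" and F0: "graph F0"
    and P: "\<And>e x y. e \<in> edges F0 \<Longrightarrow> x \<in> e \<Longrightarrow> y \<in> e \<Longrightarrow> P x = P y"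
    and xy: "x \<in> verts F0" "y \<in> verts F0"
  shows "P x = P y"
proof -
  let ?Q = "P(w := P u)"
  have wF0: "w \<notin> e" if "e \<in> edges F0" for e using w graph_edge_subset[OF F0 that] by blast
  have step: "?Q a = ?Q b" if "{a, b} \<in> edges F" for a b
  proof -
    have "{a, b} = {u, w} \<or> {a, b} = {v, w} \<or> {a, b} \<in> edges F0"
      using that F(2) by (auto simp: subdivide_edge_def)
    moreover have "P v = P u" using P[OF uv] by simp
    moreover have "?Q a = ?Q b" if e: "{a, b} \<in> edges F0"
      using P[OF e, of a b] wF0[OF e] by auto
    ultimately show ?thesis by (auto simp: doubleton_eq_iff)
  qed
  have "(x, y) \<in> {(a, b). {a, b} \<in> edges F}\<^sup>*"
    using F xy unfolding connected_graph_def by (simp add: subdivide_edge_def)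
  then have "?Q x = ?Q y" by (induction rule: rtrancl_induct) (use step in auto)
  then show ?thesis using w xy by (metis fun_upd_other)
qed

text \<open>The set \<open>C\<close> contains the copy of \<open>F\<^sub>0\<close> and meets each of its hyperedges \<open>g e\<close> exactly in the
  edge \<open>e\<close>, so a vertex \<open>b \<notin> C\<close> is new and can be the subdividing vertex \<open>w\<close>.\<close>

lemma subdivided_berge_copy_aux:
  assumes F0: "graph F0" and uv: "{u, v} \<in> edges F0" and w: "w \<notin> verts F0"
    and H: "hypergraph H"
    and \<phi>: "inj_on \<phi> (verts F0)" "\<phi> ` verts F0 \<subseteq> C" "C \<subseteq> verts H"
    and g: "\<And>e. e \<in> edges F0 \<Longrightarrow> g e \<in> edges H \<and> g e \<inter> C = \<phi> ` e"
    and b: "b \<in> g {u, v}" "b \<notin> C"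
    and k: "k \<in> edges H" "k \<notin> g ` edges F0" "{\<phi> u, b} \<subseteq> k"
  shows "\<not> berge_free (subdivide_edge F0 u v w) H"
proof -
  let ?F = "subdivide_edge F0 u v w"
  let ?\<phi> = "\<phi>(w := b)"
  let ?g = "\<lambda>e. if e = {u, w} then k else if e = {v, w} then g {u, v} else g e"
  have uvV: "u \<in> verts F0" "v \<in> verts F0" using graph_edge_subset[OF F0 uv] by auto
  have uv_ne: "u \<noteq> v" using graph_edge_card[OF F0 uv] by auto
  have wF0: "w \<notin> e" if "e \<in> edges F0" for e using w graph_edge_subset[OF F0 that] by blast
  have edgesF: "e = {u, w} \<or> e = {v, w} \<or> (e \<in> edges F0 \<and> e \<noteq> {u, v})" if "e \<in> edges ?F" for e
    using that by (auto simp: subdivide_edge_def)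
  have imgs: "e = e'" if "e \<in> edges F0" "e' \<in> edges F0" "g e = g e'" for e e'
  proof -
    have "\<phi> ` e = \<phi> ` e'" using g that by metis
    then show ?thesis
      using \<phi>(1) graph_edge_subset[OF F0] that by (metis inj_on_image_eq_iff)
  qed
  have bH: "b \<in> verts H" using b(1) g[OF uv] H by (auto simp: hypergraph_def)
  have new: "{u, w} \<notin> edges F0" "{v, w} \<notin> edges F0" using wF0 by auto
  have ne: "{u, w} \<noteq> {v, w}" using uv_ne by (auto simp: doubleton_eq_iff)
  have "hypergraph ?F"
    using graph_hypergraph[OF F0] uvV by (auto simp: hypergraph_def subdivide_edge_def)
  moreover have "inj_on ?\<phi> (verts ?F)"
    using \<phi>(1,2) b(2) w by (auto simp: inj_on_def subdivide_edge_def)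
  moreover have "?\<phi> ` verts ?F \<subseteq> verts H"
    using \<phi>(2,3) bH by (auto simp: subdivide_edge_def)
  moreover have "inj_on ?g (edges ?F)"
  proof (rule inj_onI)
    fix e e' assume "e \<in> edges ?F" "e' \<in> edges ?F" and eq: "?g e = ?g e'"
    have kg: "k \<noteq> g e" if "e \<in> edges F0" for e using k(2) that by blast
    from edgesF[OF \<open>e \<in> edges ?F\<close>] edgesF[OF \<open>e' \<in> edges ?F\<close>] show "e = e'"
      using eq new ne kg imgs uv by (elim disjE) (auto split: if_splits)
  qed
  moreover have "?g e \<in> edges H \<and> ?\<phi> ` e \<subseteq> ?g e" if "e \<in> edges ?F" for e
    using edgesF[OF that]
  proof (elim disjE)
    assume e: "e = {u, w}"
    then have "?\<phi> ` e = {\<phi> u, b}" using uvV w by auto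
    then show ?thesis using k e by simp
  next
    assume e: "e = {v, w}"
    then have "?\<phi> ` e = {\<phi> v, b}" using uvV w by auto
    moreover have "\<phi> v \<in> g {u, v}" using g[OF uv] by blast
    ultimately show ?thesis using b(1) g[OF uv] e ne by simp
  next
    assume e: "e \<in> edges F0 \<and> e \<noteq> {u, v}"
    then have "?\<phi> ` e = \<phi> ` e" using wF0 by (intro image_cong) auto
    then show ?thesis using g[of e] e new by auto
  qed
  ultimately show ?thesis using H by (intro not_berge_free_if_embedding)
qed

lemma subdivided_berge_copy:
  assumes F0: "graph F0" and uv: "{u, v} \<in> edges F0" and w: "w \<notin> verts F0"
    and H: "hypergraph H"
    and \<phi>: "inj_on \<phi> (verts F0)" "\<phi> ` verts F0 \<subseteq> C" "C \<subseteq> verts H"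
    and g: "\<And>e. e \<in> edges F0 \<Longrightarrow> g e \<in> edges H \<and> g e \<inter> C = \<phi> ` e"
    and b: "b \<in> g {u, v}" "b \<notin> C"
    and k: "k \<in> edges H" "k \<notin> g ` edges F0" "a \<in> {u, v}" "{\<phi> a, b} \<subseteq> k"
  shows "\<not> berge_free (subdivide_edge F0 u v w) H"
proof (cases "a = u")
  case True
  then show ?thesis using subdivided_berge_copy_aux[OF F0 uv w H \<phi> g b k(1,2)] k by blast
next
  case False
  then have "{\<phi> v, b} \<subseteq> k" using k by auto
  moreover have "subdivide_edge F0 u v w = subdivide_edge F0 v u w"
    by (auto simp: subdivide_edge_def insert_commute)
  moreover have "{v, u} \<in> edges F0" "b \<in> g {v, u}" using uv b by (simp_all add: insert_commute)
  ultimately show ?thesis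
    using subdivided_berge_copy_aux[OF F0 _ w H \<phi> g _ b(2) k(1,2)] by metis
qed

section \<open>Decomposition of a Berge-free hypergraph\<close>

lemma maximal_linear_subfamily:
  assumes "finite E"
  obtains L where "L \<subseteq> E" "\<And>e f. e \<in> L \<Longrightarrow> f \<in> L \<Longrightarrow> e \<noteq> f \<Longrightarrow> card (e \<inter> f) \<le> 1"
    "\<And>h. h \<in> E - L \<Longrightarrow> \<exists>k\<in>L. card (h \<inter> k) \<ge> 2"
proof -
  define lin where "lin L \<longleftrightarrow> L \<subseteq> E \<and> (\<forall>e\<in>L. \<forall>f\<in>L. e \<noteq> f \<longrightarrow> card (e \<inter> f) \<le> 1)" for L
  have "lin {}" by (simp add: lin_def)
  moreover have "\<forall>L. lin L \<longrightarrow> card L < card E + 1"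
    using assms by (auto simp: lin_def less_Suc_eq_le intro: card_mono)
  ultimately obtain L where linL: "lin L" and max: "\<And>L'. lin L' \<Longrightarrow> card L' \<le> card L"
    using ex_has_greatest_nat[of lin "{}" card] by blast
  have L: "L \<subseteq> E" "\<And>e f. e \<in> L \<Longrightarrow> f \<in> L \<Longrightarrow> e \<noteq> f \<Longrightarrow> card (e \<inter> f) \<le> 1"
    using linL by (auto simp: lin_def)
  have "\<exists>k\<in>L. card (h \<inter> k) \<ge> 2" if h: "h \<in> E - L" for h
  proof (rule ccontr)
    assume "\<not> ?thesis"
    then have "\<forall>k\<in>L. card (h \<inter> k) \<le> 1" by force
    then have "lin (insert h L)"
      using L h by (auto simp: lin_def Int_commute)
    then have "card (insert h L) \<le> card L" by (rule max)
    moreover have "finite L" using L(1) assms finite_subset by blast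
    ultimately show False using h by simp
  qed
  then show ?thesis using that[OF L] by blast
qed

text \<open>A pair that is not good for \<open>h\<close> becomes good by exchanging one of its vertices. If \<open>p\<close> avoids
  \<open>k\<close>, the pair \<open>{a, b}\<close> has \<open>b \<in> k\<close>, and a second common vertex of \<open>h\<close> and \<open>k\<close>
  serves as \<open>b'\<close>; otherwise the hypothesis forces \<open>h \<inter> k = p\<close>, and \<open>b \<in> h - k\<close> works, with the
  other vertex of \<open>p\<close> as \<open>b'\<close>.\<close>

lemma alternative_pair:
  assumes h: "card h = r" "card k = r" "h \<noteq> k" "finite h" "finite k" "card (h \<inter> k) \<ge> 2"
    and p: "p \<subseteq> h" "card p = 2"
    and bad: "\<not> (\<exists>a\<in>p. \<exists>b\<in>h - p. {a, b} \<subseteq> k)"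
  shows "\<exists>a\<in>p. \<exists>b\<in>h - p. \<exists>a'\<in>{a, b}. \<exists>b'\<in>h - {a, b}. {a', b'} \<subseteq> k"
proof (cases "p \<inter> k = {}")
  case True
  obtain B where B: "B \<subseteq> h \<inter> k" "card B = 2" using h(6) by (meson obtain_subset_with_card_n)
  then obtain b b' where bb: "B = {b, b'}" "b \<noteq> b'" by (auto simp: card_2_iff)
  obtain a where a: "a \<in> p" using p(2) by fastforce
  have "b \<in> h - p" "b' \<in> h - {a, b}" "{b, b'} \<subseteq> k" using B bb True a by auto
  then show ?thesis using a by blast
next
  case False
  then obtain a where a: "a \<in> p" "a \<in> k" by blast
  have sub: "h \<inter> k \<subseteq> p" using bad a by auto
  have fp: "finite p" using p h(4) finite_subset by blast
  have eq: "h \<inter> k = p"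
    by (rule card_seteq[OF fp sub]) (use h(6) p(2) in simp)
  obtain b where b: "b \<in> h" "b \<notin> k"
    using h(1-5) by (metis card_subset_eq subsetI)
  obtain c where c: "c \<in> p" "c \<noteq> a" using p(2) by (metis card_2_iff insert_iff)
  have "b \<in> h - p" "c \<in> h - {a, b}" "{a, c} \<subseteq> k" using b c a eq by auto
  then show ?thesis using a by blast
qed

text \<open>By random separation, it suffices to exclude a copy of \<open>F\<^sub>0\<close> among the pairs separated by a
  given set. The condition \<open>spare\<close> provides, for each matched hyperedge, a vertex \<open>b\<close> to subdivide its pair and a hyperedge \<open>k\<close>
  for the new edge \<open>{a, b}\<close> that is either unmatched or matched to \<open>{a, b}\<close> itself; as \<open>a\<close> and \<open>b\<close>
  are separated, \<open>k\<close> is not used by the copy of \<open>F\<^sub>0\<close> in the latter case either.\<close>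

lemma matched_pairs_bound:
  fixes H :: "nat hgraph"
  assumes F0: "graph F0" and F: "connected_graph F" "F = subdivide_edge F0 u v w"
    and uv: "{u, v} \<in> edges F0" and w: "w \<notin> verts F0"
    and r: "r \<ge> 1" and H: "uniform r H" and free: "berge_free F H"
    and D: "D \<subseteq> edges H" and inj: "inj_on m D"
    and m: "\<And>h. h \<in> D \<Longrightarrow> m h \<subseteq> h \<and> card (m h) = 2"
    and spare: "\<And>h. h \<in> D \<Longrightarrow> \<exists>a\<in>m h. \<exists>b\<in>h - m h. \<exists>k\<in>edges H. {a, b} \<subseteq> k \<and>
        (k \<in> D \<longrightarrow> m k = {a, b})"
  shows "card D \<le> 2 ^ (r - 1) * ex_edges (card (verts H)) F0"
proof (rule separation_average[OF _ r])
  have Hh: "hypergraph H" using H by (simp add: uniform_def)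
  then show finV: "finite (verts H)" by (simp add: hypergraph_def)
  have hV: "h \<subseteq> verts H" "card h = r" if "h \<in> D" for h
    using that D H by (auto simp: uniform_def hypergraph_def)
  show "h \<subseteq> verts H \<and> card h = r \<and> m h \<subseteq> h \<and> m h \<noteq> {}" if "h \<in> D" for h
    using hV[OF that] m[OF that] by auto
  fix A assume "A \<subseteq> verts H"
  let ?T = "{h \<in> D. A \<inter> h = m h \<or> A \<inter> h = h - m h}"
  let ?G = "\<lparr>verts = verts H, edges = m ` ?T\<rparr>"
  have G: "graph ?G"
    using finV hV m by (fastforce simp: graph_def uniform_def hypergraph_def)
  have "free_of F0 ?G"
  proof (rule ccontr)
    assume "\<not> free_of F0 ?G"
    then obtain \<phi> where \<phi>: "inj_on \<phi> (verts F0)" "\<phi> ` verts F0 \<subseteq> verts H"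
        and \<phi>E: "\<forall>e\<in>edges F0. \<phi> ` e \<in> m ` ?T"
      unfolding not_free_of_iff_embedding[OF graph_hypergraph[OF F0]] by auto
    have "\<forall>e\<in>edges F0. \<exists>h. h \<in> ?T \<and> m h = \<phi> ` e"
    proof
      fix e assume "e \<in> edges F0"
      with \<phi>E have "\<phi> ` e \<in> m ` ?T" by (rule bspec)
      then show "\<exists>h. h \<in> ?T \<and> m h = \<phi> ` e" by (elim imageE) (intro exI conjI, auto)
    qed
    from bchoice[OF this] obtain g where g: "\<And>e. e \<in> edges F0 \<Longrightarrow> g e \<in> ?T \<and> m (g e) = \<phi> ` e"
      by (elim exE) (rule that, erule bspec)
    have same: "(\<phi> x \<in> A) = (\<phi> y \<in> A)" if "e \<in> edges F0" "x \<in> e" "y \<in> e" for e x y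
    proof -
      have "\<phi> x \<in> m (g e)" "\<phi> y \<in> m (g e)" using g[OF that(1)] that(2,3) by auto
      then show ?thesis using g[OF that(1)] m[of "g e"] by blast
    qed
    have uV: "u \<in> verts F0" using graph_edge_subset[OF F0 uv] by auto
    have const: "(\<phi> x \<in> A) = (\<phi> u \<in> A)" if "x \<in> verts F0" for x
      by (rule side_constant_if_subdivision_connected[OF F uv w F0 _ that uV,
            where P = "\<lambda>x. \<phi> x \<in> A"]) (rule same)
    \<comment> \<open>The side of the separation that contains the copy of \<open>F\<^sub>0\<close>.\<close>
    define C where "C = (if \<phi> u \<in> A then A else verts H - A)"
    have CV: "C \<subseteq> verts H" using \<open>A \<subseteq> verts H\<close> by (auto simp: C_def)
    have \<phi>C: "\<phi> ` verts F0 \<subseteq> C" using const \<phi>(2) by (auto simp: C_def)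
    have trace: "g e \<in> edges H \<and> g e \<inter> C = \<phi> ` e" if e: "e \<in> edges F0" for e
    proof -
      have ge: "g e \<in> D" "m (g e) = \<phi> ` e" "A \<inter> g e = m (g e) \<or> A \<inter> g e = g e - m (g e)"
        using g[OF e] by auto
      have mC: "m (g e) \<subseteq> C" using ge(2) \<phi>C graph_edge_subset[OF F0 e] by auto
      have ne: "m (g e) \<noteq> {}" "m (g e) \<subseteq> g e" using m[OF ge(1)] by auto
      have "g e \<inter> C = m (g e)"
      proof (cases "\<phi> u \<in> A")
        case True
        then have "C = A" by (simp add: C_def)
        then show ?thesis using ge(3) mC ne by blast
      next
        case False
        then have "C = verts H - A" by (simp add: C_def)
        then show ?thesis using ge(3) mC ne hV(1)[OF ge(1)] by blast
      qed
      then show ?thesis using ge D by auto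
    qed
    let ?h = "g {u, v}"
    have hD: "?h \<in> D" and mh: "m ?h = {\<phi> u, \<phi> v}" using g[OF uv] by auto
    obtain a b k where a: "a \<in> m ?h" and b: "b \<in> ?h - m ?h" and k: "k \<in> edges H" "{a, b} \<subseteq> k"
        and kD: "k \<in> D \<longrightarrow> m k = {a, b}"
      using spare[OF hD] by blast
    have bC: "b \<notin> C" using trace[OF uv] b mh by auto
    have "k \<notin> g ` edges F0"
    proof
      assume "k \<in> g ` edges F0"
      then obtain e where e: "e \<in> edges F0" "k = g e" by blast
      then have "k \<in> D" "m k = \<phi> ` e" using g[OF e(1)] by auto
      then have "b \<in> \<phi> ` e" using kD by auto
      then show False using bC \<phi>C graph_edge_subset[OF F0 e(1)] by auto
    qed
    moreover obtain a' where "a' \<in> {u, v}" "a = \<phi> a'" using a mh by auto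
    ultimately have "\<not> berge_free (subdivide_edge F0 u v w) H"
      using subdivided_berge_copy[OF F0 uv w Hh \<phi>(1) \<phi>C CV, of g b k a'] trace bC k b by blast
    then show False using free F(2) by simp
  qed
  then have "card (edges ?G) \<le> ex_edges (card (verts ?G)) F0" by (rule ex_edges_upper[OF G])
  moreover have "card (m ` ?T) = card ?T"
    by (rule card_image) (rule inj_on_subset[OF inj], blast)
  ultimately show "card ?T \<le> ex_edges (card (verts H)) F0" by simp
qed

text \<open>The hyperedges of \<open>H\<close> are split into \<open>L\<close>, the family \<open>Z\<close> of blue cliques and those matched
  to the \<open>t\<close> red pairs; the blue graph \<open>B\<close> consists of the pairs contained in members of \<open>Z\<close>.\<close>

lemma berge_free_decomposition:
  fixes H :: "nat hgraph"
  assumes F0: "graph F0" and F: "connected_graph F" "F = subdivide_edge F0 u v w"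
    and uv: "{u, v} \<in> edges F0" and w: "w \<notin> verts F0"
    and r: "r \<ge> 1" and H: "uniform r H" and free: "berge_free F H"
  obtains B Z t where "graph B" "verts B = verts H" "free_of F B"
    and "\<And>h. h \<in> Z \<Longrightarrow> h \<subseteq> verts B \<and> card h = r"
    and "\<And>h e. h \<in> Z \<Longrightarrow> e \<subseteq> h \<Longrightarrow> card e = 2 \<Longrightarrow> e \<in> edges B"
    and "card (edges H) \<le> card Z + t + ex_berge_lin r (card (verts H)) F"
    and "card (edges B) + t \<le> 2 ^ (r - 1) * ex_edges (card (verts H)) F0"
proof -
  have Hh: "hypergraph H" using H by (simp add: uniform_def)
  then have finV: "finite (verts H)" by (simp add: hypergraph_def)
  have hE: "h \<subseteq> verts H" "card h = r" "finite h" if "h \<in> edges H" for h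
    using that H finV by (auto simp: uniform_def hypergraph_def finite_subset)
  have finE: "finite (edges H)"
    by (rule finite_subset[of _ "Pow (verts H)"]) (use hE finV in auto)
  obtain L where L: "L \<subseteq> edges H" "\<And>e f. e \<in> L \<Longrightarrow> f \<in> L \<Longrightarrow> e \<noteq> f \<Longrightarrow> card (e \<inter> f) \<le> 1"
      and Lmax: "\<And>h. h \<in> edges H - L \<Longrightarrow> \<exists>k\<in>L. card (h \<inter> k) \<ge> 2"
    using maximal_linear_subfamily[OF finE] by metis
  have L_le: "card L \<le> ex_berge_lin r (card (verts H)) F"
  proof -
    let ?L = "\<lparr>verts = verts H, edges = L\<rparr>"
    have "uniform r ?L" "linear_hypergraph ?L"
      using L H by (auto simp: uniform_def hypergraph_def linear_hypergraph_def)
    then show ?thesis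
      using ex_berge_lin_upper[of r ?L F] berge_free_subfamily[OF free L(1)] by simp
  qed
  define R where "R = edges H - L"
  have finR: "finite R" using finE by (simp add: R_def)
  define E where "E h p \<longleftrightarrow> p \<subseteq> h \<and> card p = 2" for h p :: "nat set"
  define good where "good h p \<longleftrightarrow> (\<exists>a\<in>p. \<exists>b\<in>h - p. \<exists>k\<in>L. {a, b} \<subseteq> k)" for h p :: "nat set"
  obtain m where m: "matching R E m"
      and mmax: "\<And>m'. matching R E m' \<Longrightarrow> card (ran m') \<le> card (ran m)"
      and mgood: "\<And>h p q. m h = Some p \<Longrightarrow> E h q \<Longrightarrow> \<not> good h p \<Longrightarrow> good h q \<Longrightarrow> q \<in> ran m"
    using prioritised_maximum_matching[OF finR, of E good] by blast
  obtain Z where Z: "Z \<subseteq> R" "\<And>h p. h \<in> Z \<Longrightarrow> E h p \<Longrightarrow> p \<in> ran m" "R - Z \<subseteq> dom m"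
      "\<And>h h' p. h \<in> R - Z \<Longrightarrow> h' \<in> Z \<Longrightarrow> m h = Some p \<Longrightarrow> \<not> E h' p"
    using maximum_matching_split[OF finR m mmax] by blast
  have domR: "dom m \<subseteq> R" and mE: "\<And>h p. m h = Some p \<Longrightarrow> E h p"
    using m by (auto simp: matching_def)
  let ?m = "\<lambda>h. the (m h)"
  note inj = inj_on_the_matching[OF m]
  have m2: "?m h \<subseteq> h \<and> card (?m h) = 2" if "h \<in> dom m" for h
    using that mE by (force simp: E_def)
  have spare: "\<exists>a\<in>?m h. \<exists>b\<in>h - ?m h. \<exists>k\<in>edges H. {a, b} \<subseteq> k \<and> (k \<in> dom m \<longrightarrow> ?m k = {a, b})"
    if h: "h \<in> dom m" for h
  proof (cases "good h (?m h)")
    case True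
    then obtain a b k where "a \<in> ?m h" "b \<in> h - ?m h" "k \<in> L" "{a, b} \<subseteq> k"
      unfolding good_def by blast
    moreover have "k \<notin> dom m" using \<open>k \<in> L\<close> domR by (auto simp: R_def)
    ultimately show ?thesis using L(1) by blast
  next
    case False
    have hH: "h \<in> edges H" "h \<notin> L" using h domR by (auto simp: R_def)
    obtain k where k: "k \<in> L" "card (h \<inter> k) \<ge> 2" using Lmax hH by blast
    have kH: "k \<in> edges H" using k L by blast
    have "\<exists>a\<in>?m h. \<exists>b\<in>h - ?m h. \<exists>a'\<in>{a, b}. \<exists>b'\<in>h - {a, b}. {a', b'} \<subseteq> k"
    proof (rule alternative_pair)
      show "card h = r" "card k = r" "finite h" "finite k" using hE hH kH by auto
      show "h \<noteq> k" using hH k by blast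
      show "\<not> (\<exists>a\<in>?m h. \<exists>b\<in>h - ?m h. {a, b} \<subseteq> k)"
        using False k(1) unfolding good_def by blast
    qed (use k m2[OF h] in auto)
    then obtain a b where ab: "a \<in> ?m h" "b \<in> h - ?m h" "good h {a, b}"
      using k(1) unfolding good_def by blast
    have "E h {a, b}" using ab m2[OF h] by (auto simp: E_def card_2_iff)
    then have "{a, b} \<in> ran m" using mgood[of h "?m h" "{a, b}"] h False ab(3) by auto
    then obtain k' where k': "m k' = Some {a, b}" by (auto simp: ran_def)
    then have "{a, b} \<subseteq> k'" "k' \<in> edges H" using mE domR by (auto simp: E_def R_def)
    then show ?thesis using ab(1,2) k' by (metis option.sel)
  qed
  have finran: "finite (ran m)" using finite_dom_matching(2)[OF m finR] .
  have ran_le: "card (ran m) \<le> 2 ^ (r - 1) * ex_edges (card (verts H)) F0"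
  proof -
    have "card (dom m) \<le> 2 ^ (r - 1) * ex_edges (card (verts H)) F0"
    proof (rule matched_pairs_bound[OF F0 F uv w r H free])
      show "dom m \<subseteq> edges H" using domR by (auto simp: R_def)
      show "inj_on ?m (dom m)" by (rule inj)
      show "?m h \<subseteq> h \<and> card (?m h) = 2" if "h \<in> dom m" for h by (rule m2[OF that])
      show "\<exists>a\<in>?m h. \<exists>b\<in>h - ?m h. \<exists>k\<in>edges H. {a, b} \<subseteq> k \<and> (k \<in> dom m \<longrightarrow> ?m k = {a, b})"
        if "h \<in> dom m" for h by (rule spare[OF that])
    qed
    then show ?thesis using card_ran_matching[OF m] by simp
  qed
  define B where "B = \<lparr>verts = verts H, edges = {p. \<exists>h\<in>Z. E h p}\<rparr>"
  have B_ran: "edges B \<subseteq> ran m" using Z(2) by (auto simp: B_def)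
  have ZH: "h \<in> edges H" if "h \<in> Z" for h using that Z(1) by (auto simp: R_def)
  show ?thesis
  proof (rule that[of B Z "card (?m ` (R - Z))"])
    show "graph B"
      using hE(1) ZH finV by (fastforce simp: B_def E_def graph_def uniform_def hypergraph_def)
    show "verts B = verts H" by (simp add: B_def)
    show "h \<subseteq> verts B \<and> card h = r" if "h \<in> Z" for h
      using hE ZH[OF that] by (simp add: B_def)
    show "e \<in> edges B" if "h \<in> Z" "e \<subseteq> h" "card e = 2" for h e
      using that by (auto simp: B_def E_def)
    show "free_of F B"
    proof (rule ccontr)
      have Fh: "hypergraph F" using F(1) graph_hypergraph by (auto simp: connected_graph_def)
      assume "\<not> free_of F B"
      then obtain \<phi> where \<phi>: "inj_on \<phi> (verts F)" "\<phi> ` verts F \<subseteq> verts H"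
          "\<forall>e\<in>edges F. \<phi> ` e \<in> edges B"
        unfolding not_free_of_iff_embedding[OF Fh] by (auto simp: B_def)
      have "\<forall>e\<in>edges F. \<exists>h. m h = Some (\<phi> ` e)"
        using \<phi>(3) B_ran unfolding ran_def by blast
      then obtain g where g: "\<And>e. e \<in> edges F \<Longrightarrow> m (g e) = Some (\<phi> ` e)" by metis
      have "inj_on g (edges F)"
      proof (rule inj_onI)
        fix e e' assume e: "e \<in> edges F" "e' \<in> edges F" "g e = g e'"
        then have "\<phi> ` e = \<phi> ` e'" using g by (metis option.inject)
        then show "e = e'"
          using \<phi>(1) Fh e(1,2) by (metis hypergraph_def inj_on_image_eq_iff)
      qed
      moreover have "g e \<in> edges H \<and> \<phi> ` e \<subseteq> g e" if "e \<in> edges F" for e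
        using g[OF that] mE domR by (auto simp: E_def R_def)
      ultimately have "\<not> berge_free F H"
        by (rule not_berge_free_if_embedding[OF Fh Hh \<phi>(1,2)])
      then show False using free by simp
    qed
    have red: "card (?m ` (R - Z)) = card (R - Z)"
      by (rule card_image) (rule inj_on_subset[OF inj Z(3)])
    have "card (edges H) = card L + card R"
      using L(1) finE by (simp add: R_def card_Diff_subset finite_subset card_mono)
    moreover have "card R = card Z + card (R - Z)"
      using Z(1) finR by (simp add: card_Diff_subset finite_subset card_mono)
    ultimately show "card (edges H) \<le>
        card Z + card (?m ` (R - Z)) + ex_berge_lin r (card (verts H)) F"
      using red L_le by simp
    have "edges B \<inter> ?m ` (R - Z) = {}"
    proof (rule ccontr)
      assume "edges B \<inter> ?m ` (R - Z) \<noteq> {}"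
      then obtain h where h: "h \<in> R - Z" "?m h \<in> edges B" by blast
      then obtain h' where h': "h' \<in> Z" "E h' (?m h)" by (auto simp: B_def)
      have "h \<in> dom m" using h(1) Z(3) by blast
      then have "m h = Some (?m h)" by auto
      then show False using Z(4)[OF h(1) h'(1)] h'(2) by blast
    qed
    moreover have sub: "edges B \<union> ?m ` (R - Z) \<subseteq> ran m"
      using B_ran Z(3) unfolding ran_eq_the_image by blast
    ultimately have "card (edges B) + card (?m ` (R - Z)) = card (edges B \<union> ?m ` (R - Z))"
      using finran by (metis card_Un_disjoint finite_Un finite_subset)
    also have "\<dots> \<le> card (ran m)" using sub finran by (rule card_mono[rotated])
    finally show "card (edges B) + card (?m ` (R - Z)) \<le>
        2 ^ (r - 1) * ex_edges (card (verts H)) F0" using ran_le by simp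
  qed
qed

section \<open>The bounds on the Berge extremal number\<close>

theorem theorem1p1:
  fixes r :: nat and F0 F F' :: "'a hgraph" and c :: "nat \<Rightarrow> real"
  assumes r: "r \<ge> 2"
    and F0: "graph F0"
    and F: "connected_graph F"
    and subdivision: "\<exists>u v w. {u, v} \<in> edges F0 \<and> w \<notin> verts F0 \<and> F = subdivide_edge F0 u v w"
    and deletion: "\<exists>x\<in>verts F. F' = delete_vertex F x"
    and c: "\<forall>n. \<forall>m\<le>n. real (ex_copies m (complete_graph (r - 1)) F') \<le> c n * real m"
  shows "\<forall>n.
    ex_berge r n F \<le> ex_copies n (complete_graph r) F + 2 ^ (r - 1) * ex_edges n F0 + ex_berge_lin r n F
    \<and> real (ex_berge r n F) \<le>
        max 1 (2 * c n / real r) * 2 ^ (r - 1) * real (ex_edges n F0) + real (ex_berge_lin r n F)"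
proof
  fix n
  let ?M = "max 1 (2 * c n / real r)"
  obtain u v w where uv: "{u, v} \<in> edges F0" and w: "w \<notin> verts F0"
      and Fsub: "F = subdivide_edge F0 u v w"
    using subdivision by blast
  obtain x where x: "x \<in> verts F" and F': "F' = delete_vertex F x" using deletion by blast
  have Fg: "graph F" using F by (simp add: connected_graph_def)
  show "ex_berge r n F \<le>
      ex_copies n (complete_graph r) F + 2 ^ (r - 1) * ex_edges n F0 + ex_berge_lin r n F
    \<and> real (ex_berge r n F) \<le>
        ?M * 2 ^ (r - 1) * real (ex_edges n F0) + real (ex_berge_lin r n F)"
  proof (rule ex_berge_attained[of r n F])
    assume "ex_berge r n F = 0"
    moreover have "0 \<le> ?M * 2 ^ (r - 1) * real (ex_edges n F0)"
      by (intro mult_nonneg_nonneg) auto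
    ultimately show ?thesis by simp
  next
    fix H :: "nat hgraph"
    assume H: "uniform r H" and n: "card (verts H) = n" and free: "berge_free F H"
      and ex: "ex_berge r n F = card (edges H)"
    have "r \<ge> 1" using r by simp
    then obtain B Z t where B: "graph B" "verts B = verts H" "free_of F B"
        and Z: "\<And>h. h \<in> Z \<Longrightarrow> h \<subseteq> verts B \<and> card h = r"
        and clique: "\<And>h e. h \<in> Z \<Longrightarrow> e \<subseteq> h \<Longrightarrow> card e = 2 \<Longrightarrow> e \<in> edges B"
        and total: "card (edges H) \<le> card Z + t + ex_berge_lin r n F"
        and pairs: "card (edges B) + t \<le> 2 ^ (r - 1) * ex_edges n F0"
      using berge_free_decomposition[OF F0 F Fsub uv w _ H free] n by metis
    have "card Z \<le> card (copies (complete_graph r) B)"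
      by (rule card_cliques_le_copies[OF B(1)]) (use Z clique in blast)+
    also have "\<dots> \<le> ex_copies n (complete_graph r) F"
      using ex_copies_upper[OF B(1,3)] B(2) n by simp
    finally have first: "ex_berge r n F \<le>
        ex_copies n (complete_graph r) F + 2 ^ (r - 1) * ex_edges n F0 + ex_berge_lin r n F"
      using total pairs ex by linarith
    have "real r * real (card Z) \<le> 2 * c n * real (card (edges B))"
      by (rule clique_family_bound[OF Fg x B(1,3)]) (use c F' B(2) n Z clique in auto)
    then have "real (card Z) \<le> (2 * c n / real r) * real (card (edges B))"
      using r by (simp add: field_simps)
    also have "\<dots> \<le> ?M * real (card (edges B))" by (intro mult_right_mono) auto
    finally have blue: "real (card Z) \<le> ?M * real (card (edges B))" .
    have red: "real t \<le> ?M * real t"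
      using mult_right_mono[of 1 ?M "real t"] by simp
    have "real (card Z) + real t \<le> ?M * real (card (edges B) + t)"
      using add_mono[OF blue red] by (simp only: of_nat_add distrib_left)
    also have "\<dots> \<le> ?M * real (2 ^ (r - 1) * ex_edges n F0)"
      using pairs by (intro mult_left_mono of_nat_mono) auto
    finally have "real (card Z) + real t \<le> ?M * 2 ^ (r - 1) * real (ex_edges n F0)"
      by (simp add: mult.assoc)
    then have second: "real (ex_berge r n F) \<le>
        ?M * 2 ^ (r - 1) * real (ex_edges n F0) + real (ex_berge_lin r n F)"
      using total ex by linarith
    show ?thesis using first second by blast
  qed
qed

end
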